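(* Let $n\ge2$, $\varepsilon>0$, $R>0$, and let $F:\mathbb{R}^n\to\mathbb{R}$ and $x_0\in\mathbb{R}^n$ satisfy all of the following: (i) $F\in C^\infty(\mathbb{R}^n)$ is globally strongly convex, $F-Q\in C_c^\infty(\mathbb{R}^n)$, $\operatorname{supp}(F-Q)\cup\{x_0\}\subset B(0,R)$, $\sup_{x\in\mathbb{R}^n}\lVert\nabla^2F(x)-I_n\rVert_{\mathrm{op}}<\varepsilon$, the unique minimizer of $F$ is $0$, and $\nabla^2F(0)=I_n$; (ii) BFGS with exact line search applied to $F$ from $x_0$ with $B_0=I_n$ is well defined, every $B_k$ is positive definite, the method does not terminate finitely, and its iterates $\{x_k\}_{k\ge0}$ converge to $0$; (iii) $\lVert x_{k+1}\rVert/\lVert x_k\rVert\to0$, and the Q-order of $\{x_k\}_{k\ge0}$ at the origin is one. Fix any sequence $\{\phi_k\}_{k\ge0}\subset[0,1]$. Then the convex Broyden class method with parameters $\{\phi_k\}$, exact line search, starting point $x_0$ and initialization $B_0=I_n$ generates the same nonterminating point sequence $\{x_k\}_{k\ge0}$ as BFGS. In particular, its iterates converge Q-superlinearly to the origin and have Q-order one.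
   Context: Notation: $\lVert\cdot\rVert$ is the Euclidean norm, $\lVert\cdot\rVert_{\mathrm{op}}$ the operator norm, $I_n$ the identity matrix, $B(0,R)$ the open ball, $Q(x)=\frac12\lVert x\rVert^2$, $C_c^\infty(\mathbb{R}^n)$ the smooth compactly supported functions. Quasi-Newton iteration with exact line search: given $x_k$, $g_k:=\nabla F(x_k)$ and symmetric positive definite $B_k$, solve $B_kd_k=-g_k$, choose $\alpha_k\in\arg\min_{\alpha\ge0}F(x_k+\alpha d_k)$, set $x_{k+1}=x_k+\alpha_kd_k$, $s_k:=x_{k+1}-x_k$, $y_k:=g_{k+1}-g_k$, and then update $B_k$ to $B_{k+1}$. The run is nonterminating if $\nabla F(x_k)\ne0$ for every $k$. BFGS update: $$B_{k+1}^{\mathrm{BFGS}}=B_k-\frac{B_ks_ks_k^{\mathsf T}B_k}{s_k^{\mathsf T}B_ks_k}+\frac{y_ky_k^{\mathsf T}}{s_k^{\mathsf T}y_k}.$$ DFP update: $$B_{k+1}^{\mathrm{DFP}}=\Bigl(I_n-\frac{y_ks_k^{\mathsf T}}{y_k^{\mathsf T}s_k}\Bigr)B_k\Bigl(I_n-\frac{s_ky_k^{\mathsf T}}{s_k^{\mathsf T}y_k}\Bigr)+\frac{y_ky_k^{\mathsf T}}{y_k^{\mathsf T}s_k}.$$ BFGS uses $B_{k+1}=B_{k+1}^{\mathrm{BFGS}}$. The convex Broyden class method with parameters $\phi_k\in[0,1]$ (which may vary with $k$) uses $B_{k+1}=(1-\phi_k)B_{k+1}^{\mathrm{BFGS}}+\phi_kB_{k+1}^{\mathrm{DFP}}$,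 where both endpoint updates are computed from the method's own current $B_k,s_k,y_k$. Q-order: let $x_k\to x_\star$ with $x_k\ne x_\star$ for all large $k$. For $p\ge1$ the sequence has Q-order at least $p$ at $x_\star$ if there are $C>0$, $k_0$ with $\lVert x_{k+1}-x_\star\rVert\le C\lVert x_k-x_\star\rVert^p$ for all $k\ge k_0$. Whenever some $p\ge1$ is admissible, the Q-order is the supremum of all admissible $p\ge1$. Q-superlinear convergence means $\lVert x_{k+1}-x_\star\rVert/\lVert x_k-x_\star\rVert\to0$. *)

theory Defs
  imports "HOL-Analysis.Analysis"
begin

text \<open>\<open>Ck k f\<close>: the function is \<open>k\<close> times continuously differentiable on the whole space,
  i.e. all its iterated partial derivatives up to order \<open>k\<close> exist and are continuous.\<close>

fun Ck :: "nat \<Rightarrow> (real ^ 'n \<Rightarrow> real) \<Rightarrow> bool" where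
  "Ck 0 f \<longleftrightarrow> continuous_on UNIV f"
| "Ck (Suc k) f \<longleftrightarrow> (\<forall>x. f differentiable (at x)) \<and>
     (\<forall>i. Ck k (\<lambda>x. frechet_derivative f (at x) (axis i 1)))"

definition smooth :: "(real ^ 'n \<Rightarrow> real) \<Rightarrow> bool" where
  "smooth f \<longleftrightarrow> (\<forall>k. Ck k f)"

definition supp :: "(real ^ 'n \<Rightarrow> real) \<Rightarrow> (real ^ 'n) set" where
  "supp f = closure (support_on UNIV f)"

definition grad :: "(real ^ 'n \<Rightarrow> real) \<Rightarrow> real ^ 'n \<Rightarrow> real ^ 'n" where
  "grad F x = (\<chi> i. frechet_derivative F (at x) (axis i 1))"

definition hessian :: "(real ^ 'n \<Rightarrow> real) \<Rightarrow> real ^ 'n \<Rightarrow> real ^ 'n ^ 'n" where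
  "hessian F x = jacobian (grad F) (at x)"

definition op_norm :: "real ^ 'n ^ 'm \<Rightarrow> real" where
  "op_norm A = onorm ((*v) A)"

definition strongly_convex :: "(real ^ 'n \<Rightarrow> real) \<Rightarrow> bool" where
  "strongly_convex F \<longleftrightarrow> (\<exists>m>0. \<forall>x y. \<forall>t\<in>{0..1}.
     F ((1 - t) *\<^sub>R x + t *\<^sub>R y)
       \<le> (1 - t) * F x + t * F y - m / 2 * t * (1 - t) * (norm (x - y))\<^sup>2)"

definition Q :: "real ^ 'n \<Rightarrow> real" where
  "Q x = (norm x)\<^sup>2 / 2"

definition outer :: "real ^ 'n \<Rightarrow> real ^ 'n \<Rightarrow> real ^ 'n ^ 'n" where
  "outer u v = (\<chi> i j. u $ i * v $ j)"

definition sym_pos_def :: "real ^ 'n ^ 'n \<Rightarrow> bool" where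
  "sym_pos_def B \<longleftrightarrow> transpose B = B \<and> (\<forall>v. v \<noteq> 0 \<longrightarrow> v \<bullet> (B *v v) > 0)"

definition bfgs :: "real ^ 'n ^ 'n \<Rightarrow> real ^ 'n \<Rightarrow> real ^ 'n \<Rightarrow> real ^ 'n ^ 'n" where
  "bfgs B s y = B - (1 / (s \<bullet> (B *v s))) *\<^sub>R outer (B *v s) (s v* B)
                  + (1 / (s \<bullet> y)) *\<^sub>R outer y y"

definition dfp :: "real ^ 'n ^ 'n \<Rightarrow> real ^ 'n \<Rightarrow> real ^ 'n \<Rightarrow> real ^ 'n ^ 'n" where
  "dfp B s y = (mat 1 - (1 / (y \<bullet> s)) *\<^sub>R outer y s) ** B ** (mat 1 - (1 / (s \<bullet> y)) *\<^sub>R outer s y)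
                  + (1 / (y \<bullet> s)) *\<^sub>R outer y y"

definition broyden :: "real \<Rightarrow> real ^ 'n ^ 'n \<Rightarrow> real ^ 'n \<Rightarrow> real ^ 'n \<Rightarrow> real ^ 'n ^ 'n" where
  "broyden \<phi> B s y = (1 - \<phi>) *\<^sub>R bfgs B s y + \<phi> *\<^sub>R dfp B s y"

text \<open>One iteration from \<open>(x, B)\<close> to \<open>(x', B')\<close> with update formula \<open>U\<close>. Since division by
  zero is total in HOL, the denominators of the update formulas are explicitly required to be
  nonzero. In particular no iteration is possible from a point where the gradient vanishes.\<close>

definition qn_step ::
  "(real ^ 'n \<Rightarrow> real) \<Rightarrow> (real ^ 'n ^ 'n \<Rightarrow> real ^ 'n \<Rightarrow> real ^ 'n \<Rightarrow> real ^ 'n ^ 'n) \<Rightarrow>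
   real ^ 'n \<Rightarrow> real ^ 'n ^ 'n \<Rightarrow> real ^ 'n \<Rightarrow> real ^ 'n ^ 'n \<Rightarrow> bool" where
  "qn_step F U x B x' B' \<longleftrightarrow>
     sym_pos_def B \<and>
     (\<exists>d \<alpha>. B *v d = - grad F x \<and>
            is_arg_min (\<lambda>\<alpha>. F (x + \<alpha> *\<^sub>R d)) (\<lambda>\<alpha>. \<alpha> \<ge> 0) \<alpha> \<and>
            x' = x + \<alpha> *\<^sub>R d) \<and>
     (let s = x' - x; y = grad F x' - grad F x in
        s \<bullet> y \<noteq> 0 \<and> s \<bullet> (B *v s) \<noteq> 0 \<and> B' = U B s y)"

text \<open>The first \<open>N\<close> iterations of the method that uses the update formula \<open>U k\<close> in iteration
  \<open>k\<close>; the values of \<open>x\<close> and \<open>B\<close> beyond index \<open>N\<close> are irrelevant.\<close>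

definition qn_run_upto ::
  "(real ^ 'n \<Rightarrow> real) \<Rightarrow> (nat \<Rightarrow> real ^ 'n ^ 'n \<Rightarrow> real ^ 'n \<Rightarrow> real ^ 'n \<Rightarrow> real ^ 'n ^ 'n) \<Rightarrow>
   real ^ 'n \<Rightarrow> real ^ 'n ^ 'n \<Rightarrow> nat \<Rightarrow> (nat \<Rightarrow> real ^ 'n) \<Rightarrow> (nat \<Rightarrow> real ^ 'n ^ 'n) \<Rightarrow> bool" where
  "qn_run_upto F U x0 B0 N x B \<longleftrightarrow>
     x 0 = x0 \<and> B 0 = B0 \<and>
     (\<forall>k<N. qn_step F (U k) (x k) (B k) (x (Suc k)) (B (Suc k)))"

definition qn_run ::
  "(real ^ 'n \<Rightarrow> real) \<Rightarrow> (nat \<Rightarrow> real ^ 'n ^ 'n \<Rightarrow> real ^ 'n \<Rightarrow> real ^ 'n \<Rightarrow> real ^ 'n ^ 'n) \<Rightarrow>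
   real ^ 'n \<Rightarrow> real ^ 'n ^ 'n \<Rightarrow> (nat \<Rightarrow> real ^ 'n) \<Rightarrow> (nat \<Rightarrow> real ^ 'n ^ 'n) \<Rightarrow> bool" where
  "qn_run F U x0 B0 x B \<longleftrightarrow> (\<forall>N. qn_run_upto F U x0 B0 N x B)"

definition nonterminating :: "(real ^ 'n \<Rightarrow> real) \<Rightarrow> (nat \<Rightarrow> real ^ 'n) \<Rightarrow> bool" where
  "nonterminating F x \<longleftrightarrow> (\<forall>k. grad F (x k) \<noteq> 0)"

text \<open>Convergence to \<open>a\<close> with \<open>x k \<noteq> a\<close> for all large \<open>k\<close>: the standing assumption under which
  rates of convergence are defined.\<close>

definition converges_properly :: "(nat \<Rightarrow> real ^ 'n) \<Rightarrow> real ^ 'n \<Rightarrow> bool" where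
  "converges_properly x a \<longleftrightarrow> x \<longlonglongrightarrow> a \<and> (\<forall>\<^sub>F k in sequentially. x k \<noteq> a)"

definition Q_superlinear :: "(nat \<Rightarrow> real ^ 'n) \<Rightarrow> real ^ 'n \<Rightarrow> bool" where
  "Q_superlinear x a \<longleftrightarrow> converges_properly x a \<and>
     (\<lambda>k. norm (x (Suc k) - a) / norm (x k - a)) \<longlonglongrightarrow> 0"

definition Q_order_at_least :: "real \<Rightarrow> (nat \<Rightarrow> real ^ 'n) \<Rightarrow> real ^ 'n \<Rightarrow> bool" where
  "Q_order_at_least p x a \<longleftrightarrow> converges_properly x a \<and>
     (\<exists>C>0. \<exists>k0. \<forall>k\<ge>k0. norm (x (Suc k) - a) \<le> C * norm (x k - a) powr p)"

text \<open>The Q-order is an extended real, and is undefined when no \<open>p \<ge> 1\<close> is admissible; hence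
  it is rendered as a relation.\<close>

definition has_Q_order :: "(nat \<Rightarrow> real ^ 'n) \<Rightarrow> real ^ 'n \<Rightarrow> ereal \<Rightarrow> bool" where
  "has_Q_order x a q \<longleftrightarrow>
     (\<exists>p\<ge>1. Q_order_at_least p x a) \<and>
     q = Sup (ereal ` {p. p \<ge> 1 \<and> Q_order_at_least p x a})"

end

theory Submission
  imports Defs
begin

text \<open>Exact line search makes \<open>B\<^sub>k s\<^sub>k\<close> parallel to \<open>g\<^sub>k\<close> and \<open>g\<^sub>k\<^sub>+\<^sub>1\<close> orthogonal to \<open>s\<^sub>k\<close>. Hence the
  vector \<open>y\<^sub>k / (s\<^sub>k \<bullet> y\<^sub>k) - B\<^sub>k s\<^sub>k / (s\<^sub>k \<bullet> B\<^sub>k s\<^sub>k)\<close>, whose outer square is up to a factor the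
  difference of the DFP and BFGS updates, is a multiple of \<open>g\<^sub>k\<^sub>+\<^sub>1\<close>. The Broyden matrices therefore
  stay of the form \<open>B\<^sub>k + c\<^sub>k g\<^sub>k g\<^sub>k\<^sup>T\<close> with \<open>c\<^sub>k \<ge> 0\<close>, where \<open>B\<^sub>k\<close> are the BFGS matrices: the
  rank-one term only rescales the search direction by a positive factor, and the BFGS part of the
  next update cancels it. This is Dixon's argument.\<close>

section \<open>Rank-one matrices and the update formulas\<close>

lemma matrix_mult_outer: "A ** outer u v = outer (A *v u) v"
  by (simp add: vec_eq_iff outer_def matrix_matrix_mult_def matrix_vector_mult_def
      sum_distrib_right mult.assoc)

lemma outer_mult_matrix: "outer u v ** A = outer u (v v* A)"
  by (simp add: vec_eq_iff outer_def matrix_matrix_mult_def vector_matrix_mult_def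
      sum_distrib_left mult_ac)

lemma outer_mult_vector: "outer u v *v w = (v \<bullet> w) *\<^sub>R u"
  by (simp add: vec_eq_iff outer_def matrix_vector_mult_def inner_vec_def
      sum_distrib_left mult_ac)

lemma outer_scaleR: "outer (a *\<^sub>R u) (b *\<^sub>R v) = (a * b) *\<^sub>R outer u v"
  by (simp add: vec_eq_iff outer_def mult_ac)

lemma transpose_outer: "transpose (outer u v) = outer v u"
  by (simp add: vec_eq_iff outer_def transpose_def mult.commute)

lemma transpose_add: "transpose (A + B) = transpose A + transpose (B :: real ^ 'n ^ 'm)"
  by (simp add: vec_eq_iff transpose_def)

lemma matrix_diff_ldistrib: "A ** (B - C) = A ** B - A ** (C :: real ^ 'n ^ 'm)"
  by (simp add: vec_eq_iff matrix_matrix_mult_def sum_subtractf right_diff_distrib)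

lemma matrix_diff_rdistrib: "(A - B) ** C = A ** C - B ** (C :: real ^ 'n ^ 'm)"
  by (simp add: vec_eq_iff matrix_matrix_mult_def sum_subtractf left_diff_distrib)

lemma vector_matrix_mult_symmetric:
  assumes "transpose B = (B :: real ^ 'n ^ 'n)"
  shows "s v* B = B *v s"
  using assms by (metis vector_transpose_matrix)

text \<open>Write \<open>b = B *v s\<close> and \<open>r = 1 / (s \<bullet> y)\<close>. Expanding
  the DFP product leaves the mixed terms
  \<open>- r *\<^sub>R outer y b - r *\<^sub>R outer b y\<close>. Completing the square turns these
  and the term in \<open>r * r\<close> into the outer square of \<open>v\<close>, at the price of
  subtracting \<open>outer b b\<close> divided by \<open>s \<bullet> b\<close>, which is the term
  that BFGS subtracts.\<close>

lemma dfp_eq_bfgs_plus_outer: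
  fixes B :: "real ^ 'n ^ 'n"
  assumes sym: "transpose B = B" and "s \<bullet> (B *v s) \<noteq> 0" and "s \<bullet> y \<noteq> 0"
  defines "v \<equiv> (1 / (s \<bullet> y)) *\<^sub>R y - (1 / (s \<bullet> (B *v s))) *\<^sub>R (B *v s)"
  shows "dfp B s y = bfgs B s y + (s \<bullet> (B *v s)) *\<^sub>R outer v v"
proof -
  define b where "b = B *v s"
  define r where "r = 1 / (s \<bullet> y)"
  have sB: "s v* B = b"
    by (simp add: b_def vector_matrix_mult_symmetric[OF sym])
  have prod: "(mat 1 - r *\<^sub>R outer y s) ** B ** (mat 1 - r *\<^sub>R outer s y)
      = B - r *\<^sub>R outer y b - r *\<^sub>R outer b y + (r * r * (s \<bullet> b)) *\<^sub>R outer y y"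
  proof -
    have "outer y s ** B = outer y b"
      by (simp add: outer_mult_matrix sB)
    moreover have "outer y b ** outer s y = (s \<bullet> b) *\<^sub>R outer y y"
      using outer_scaleR[of "b \<bullet> s" y 1 y]
      by (simp add: matrix_mult_outer outer_mult_vector inner_commute)
    moreover have "B ** outer s y = outer b y"
      by (simp add: matrix_mult_outer b_def)
    ultimately show ?thesis
      by (simp add: matrix_diff_ldistrib matrix_diff_rdistrib matrix_scalar_ac
          scalar_matrix_assoc[symmetric] algebra_simps)
  qed
  show ?thesis
    using assms(2,3) unfolding dfp_def bfgs_def sB inner_commute[of y s] b_def[symmetric] v_def
      r_def[symmetric] prod
    by (simp add: r_def vec_eq_iff outer_def field_simps)
qed

text \<open>Put \<sigma> = \<open>g \<bullet> s\<close>. If \<open>B *v s = l *\<^sub>R g\<close>,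
  the term that BFGS subtracts is l / \<sigma> times \<open>outer g g\<close>. Perturbing
  \<open>B\<close> by \<open>c *\<^sub>R outer g g\<close> replaces \<open>l\<close> by l + c
  \<sigma>, so exactly \<open>c *\<^sub>R outer g g\<close> more is subtracted and the perturbation
  disappears.\<close>

lemma bfgs_plus_outer:
  fixes B :: "real ^ 'n ^ 'n"
  assumes sym: "transpose B = B" and Bs: "B *v s = l *\<^sub>R g"
    and "g \<bullet> s \<noteq> 0" and "l \<noteq> 0" and "l + c * (g \<bullet> s) \<noteq> 0"
  shows "bfgs (B + c *\<^sub>R outer g g) s y = bfgs B s y"
proof -
  let ?B = "B + c *\<^sub>R outer g g"
  have B's: "?B *v s = (l + c * (g \<bullet> s)) *\<^sub>R g"
    by (simp add: matrix_vector_mult_add_rdistrib scaleR_matrix_vector_assoc[symmetric]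
        outer_mult_vector Bs algebra_simps)
  have sym': "transpose ?B = ?B"
    by (simp add: transpose_add transpose_scalar transpose_outer sym)
  show ?thesis
    unfolding bfgs_def vector_matrix_mult_symmetric[OF sym] vector_matrix_mult_symmetric[OF sym'] Bs B's
    using assms(3-) by (simp add: vec_eq_iff outer_def inner_commute[of s g] divide_simps) algebra
qed

text \<open>The Broyden update is the BFGS update plus \<open>\<phi>\<close> times the difference
  between DFP and BFGS. The sign conditions make \<open>l + c * (g \<bullet> s)\<close> negative, so
  no denominator vanishes, and for \<phi> \<ge> 0 the new coefficient is nonnegative.\<close>

lemma broyden_plus_outer:
  fixes B :: "real ^ 'n ^ 'n"
  assumes sym: "transpose B = B" and Bs: "B *v s = l *\<^sub>R g"
    and "g \<bullet> s < 0" and "l < 0" and "c \<ge> 0" and "g' \<bullet> s = 0"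
  shows "broyden \<phi> (B + c *\<^sub>R outer g g) s (g' - g)
    = bfgs B s (g' - g) + (\<phi> * (l + c * (g \<bullet> s)) / (g \<bullet> s)) *\<^sub>R outer g' g'"
proof -
  let ?B = "B + c *\<^sub>R outer g g" and ?\<sigma> = "g \<bullet> s"
  define l' where "l' = l + c * ?\<sigma>"
  have l': "l' < 0"
    using assms(3-5) mult_nonneg_nonpos[of c ?\<sigma>] by (simp add: l'_def)
  have B's: "?B *v s = l' *\<^sub>R g"
    by (simp add: matrix_vector_mult_add_rdistrib scaleR_matrix_vector_assoc[symmetric]
        outer_mult_vector Bs l'_def algebra_simps)
  have sym': "transpose ?B = ?B"
    by (simp add: transpose_add transpose_scalar transpose_outer sym)
  have sy: "s \<bullet> (g' - g) = - ?\<sigma>"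
    using assms(6) by (simp add: inner_diff_right inner_commute)
  have sBs: "s \<bullet> (?B *v s) = l' * ?\<sigma>"
    by (simp add: B's inner_commute)
  \<comment> \<open>By orthogonality the first summand is \<open>g - g'\<close> divided by
    \<open>g \<bullet> s\<close>, and the term subtracted is \<open>g\<close> divided by
    \<open>g \<bullet> s\<close>. The contributions of \<open>g\<close> cancel.\<close>
  have v: "(1 / (s \<bullet> (g' - g))) *\<^sub>R (g' - g) - (1 / (s \<bullet> (?B *v s))) *\<^sub>R (?B *v s)
      = (- 1 / ?\<sigma>) *\<^sub>R g'"
    unfolding sy sBs B's using l' assms(3) by (simp add: vec_eq_iff inner_commute[of s g] field_simps)
  have "dfp ?B s (g' - g) = bfgs ?B s (g' - g) + (l' / ?\<sigma>) *\<^sub>R outer g' g'"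
  proof -
    have "s \<bullet> (?B *v s) \<noteq> 0" and "s \<bullet> (g' - g) \<noteq> 0"
      using l' assms(3) by (simp_all add: sBs sy)
    from dfp_eq_bfgs_plus_outer[OF sym' this, unfolded v, unfolded outer_scaleR sBs] show ?thesis
      using assms(3) by (simp add: field_simps)
  qed
  moreover have "bfgs ?B s (g' - g) = bfgs B s (g' - g)"
    using assms(3,4) l' by (intro bfgs_plus_outer[OF sym Bs]) (simp_all add: l'_def)
  ultimately show ?thesis
    by (simp add: broyden_def l'_def algebra_simps)
qed

section \<open>Positive definite matrices\<close>

lemma sym_pos_def_plus_outer:
  assumes "sym_pos_def B" and "c \<ge> 0"
  shows "sym_pos_def (B + c *\<^sub>R outer g g)"
  unfolding sym_pos_def_def
proof (intro conjI allI impI)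
  show "transpose (B + c *\<^sub>R outer g g) = B + c *\<^sub>R outer g g"
    using assms(1) by (simp add: sym_pos_def_def transpose_add transpose_scalar transpose_outer)
  fix v :: "real ^ 'a" assume "v \<noteq> 0"
  then have "v \<bullet> (B *v v) > 0"
    using assms(1) by (simp add: sym_pos_def_def)
  moreover have "v \<bullet> ((B + c *\<^sub>R outer g g) *v v) = v \<bullet> (B *v v) + c * (g \<bullet> v)\<^sup>2"
    by (simp add: matrix_vector_mult_add_rdistrib scaleR_matrix_vector_assoc[symmetric]
        outer_mult_vector inner_add_right inner_commute power2_eq_square)
  ultimately show "v \<bullet> ((B + c *\<^sub>R outer g g) *v v) > 0"
    using assms(2) by (simp add: add_pos_nonneg)
qed

lemma sym_pos_def_mult_vector_cancel:
  assumes "sym_pos_def B" and "B *v u = B *v v"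
  shows "u = v"
proof (rule ccontr)
  assume "u \<noteq> v"
  then have "(u - v) \<bullet> (B *v (u - v)) > 0"
    using assms(1) by (simp add: sym_pos_def_def)
  then show False
    using assms(2) by (simp add: matrix_vector_mult_diff_distrib)
qed

section \<open>Gradients and exact line search\<close>

lemma smooth_differentiable: "smooth F \<Longrightarrow> F differentiable (at x)"
  unfolding smooth_def by (metis Ck.simps(2))

lemma frechet_derivative_eq_grad_inner:
  assumes "F differentiable (at x)"
  shows "frechet_derivative F (at x) v = grad F x \<bullet> v"
proof -
  have lin: "linear (frechet_derivative F (at x))"
    using assms by (rule linear_frechet_derivative)
  have "frechet_derivative F (at x) v
      = frechet_derivative F (at x) (\<Sum>i\<in>UNIV. v $ i *\<^sub>R axis i 1)"
    using basis_expansion[of v] by (simp add: scalar_mult_eq_scaleR)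
  also have "\<dots> = grad F x \<bullet> v"
    by (simp add: linear_sum[OF lin] linear_scale[OF lin] inner_vec_def grad_def mult.commute)
  finally show ?thesis .
qed

lemma exact_line_search_orthogonal:
  assumes diff: "F differentiable (at (x + a *\<^sub>R d))"
    and min: "is_arg_min (\<lambda>a. F (x + a *\<^sub>R d)) (\<lambda>a. a \<ge> 0) a" and "a > 0"
  shows "grad F (x + a *\<^sub>R d) \<bullet> d = 0"
proof -
  let ?D = "frechet_derivative F (at (x + a *\<^sub>R d))"
  have "(F has_derivative ?D) (at (x + a *\<^sub>R d))"
    using diff frechet_derivative_works by blast
  moreover have "((\<lambda>t. x + t *\<^sub>R d) has_derivative (\<lambda>t. t *\<^sub>R d)) (at a)"
    by (auto intro!: derivative_eq_intros)
  ultimately have "((\<lambda>t. F (x + t *\<^sub>R d)) has_derivative (\<lambda>t. ?D (t *\<^sub>R d))) (at a)"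
    using has_derivative_compose by fastforce
  then have "((\<lambda>t. F (x + t *\<^sub>R d)) has_field_derivative grad F (x + a *\<^sub>R d) \<bullet> d) (at a)"
    by (simp add: frechet_derivative_eq_grad_inner[OF diff] has_field_derivative_def mult.commute[of _ "_ \<bullet> _"])
  \<comment> \<open>Since \<open>a > 0\<close>, the minimizer is interior to the half-line: the
    neighbourhood of radius \<open>a\<close> around it contains only feasible step lengths, so the
    derivative along the ray vanishes.\<close>
  then show ?thesis
  proof (rule DERIV_local_min[OF _ \<open>a > 0\<close>], intro allI impI)
    fix b assume "\<bar>a - b\<bar> < a"
    then have "b \<ge> 0"
      by linarith
    then show "F (x + a *\<^sub>R d) \<le> F (x + b *\<^sub>R d)"
      using min unfolding is_arg_min_def by (meson linorder_not_less)
  qed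
qed

text \<open>At the midpoint of two distinct minimizers the quadratic term of strong convexity would
  force a strictly smaller value.\<close>

lemma strongly_convex_line_search_unique:
  assumes "strongly_convex F" and "d \<noteq> 0"
    and a: "is_arg_min (\<lambda>a. F (x + a *\<^sub>R d)) (\<lambda>a. a \<ge> 0) a"
    and b: "is_arg_min (\<lambda>a. F (x + a *\<^sub>R d)) (\<lambda>a. a \<ge> 0) b"
  shows "a = b"
proof (rule ccontr)
  assume "a \<noteq> b"
  obtain m where "m > 0" and m: "\<And>x y t. t \<in> {0..1} \<Longrightarrow> F ((1 - t) *\<^sub>R x + t *\<^sub>R y)
       \<le> (1 - t) * F x + t * F y - m / 2 * t * (1 - t) * (norm (x - y))\<^sup>2"
    using assms(1) unfolding strongly_convex_def by blast
  let ?z = "x + ((a + b) / 2) *\<^sub>R d"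
  have mid: "(1 - 1 / 2) *\<^sub>R (x + a *\<^sub>R d) + (1 / 2) *\<^sub>R (x + b *\<^sub>R d) = ?z"
    by (simp add: vec_eq_iff field_simps)
  have "a \<ge> 0" "b \<ge> 0" and eq: "F (x + a *\<^sub>R d) = F (x + b *\<^sub>R d)"
    using a b unfolding is_arg_min_def by force+
  then have "F (x + a *\<^sub>R d) \<le> F ?z"
    using a unfolding is_arg_min_def by (simp add: linorder_not_less)
  moreover have "norm ((x + a *\<^sub>R d) - (x + b *\<^sub>R d)) > 0"
    using \<open>a \<noteq> b\<close> \<open>d \<noteq> 0\<close> by simp
  then have "m * (norm ((x + a *\<^sub>R d) - (x + b *\<^sub>R d)))\<^sup>2 > 0"
    using \<open>m > 0\<close> by simp
  ultimately show False
    using m[of "1 / 2" "x + a *\<^sub>R d" "x + b *\<^sub>R d", unfolded mid] by (simp add: eq)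
qed

text \<open>Multiplication by \<open>t > 0\<close> is a bijection of the feasible half-line. This
  transfers the line search to a rescaled search direction.\<close>

lemma line_search_scale:
  fixes x d :: "'a :: real_vector" and F :: "'a \<Rightarrow> real"
  assumes "t > 0"
  shows "is_arg_min (\<lambda>a. F (x + a *\<^sub>R (t *\<^sub>R d))) (\<lambda>a. a \<ge> 0) b
    \<longleftrightarrow> is_arg_min (\<lambda>a. F (x + a *\<^sub>R d)) (\<lambda>a. a \<ge> 0) (b * t)"
proof -
  have "(\<exists>e\<ge>0. F (x + (e * t) *\<^sub>R d) < m) \<longleftrightarrow> (\<exists>e\<ge>0. F (x + e *\<^sub>R d) < m)" for m
  proof safe
    fix e :: real assume "e \<ge> 0" "F (x + e *\<^sub>R d) < m"
    then show "\<exists>e\<ge>0. F (x + (e * t) *\<^sub>R d) < m"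
      using assms by (intro exI[of _ "e / t"]) simp
  qed (use assms in \<open>auto intro!: exI[of _ "_ * t"]\<close>)
  then show ?thesis
    using assms unfolding is_arg_min_def scaleR_scaleR by (simp add: zero_le_mult_iff)
qed

section \<open>One iteration with a rank-one perturbed matrix\<close>

lemma qn_step_exactE:
  assumes step: "qn_step F U x B x' B'" and smooth: "smooth F"
  obtains d a where "B *v d = - grad F x" and "a > 0" and "x' = x + a *\<^sub>R d"
    and "is_arg_min (\<lambda>a. F (x + a *\<^sub>R d)) (\<lambda>a. a \<ge> 0) a"
    and "grad F x \<bullet> d < 0" and "grad F x' \<bullet> d = 0"
proof -
  obtain d a where d: "B *v d = - grad F x"
    and min: "is_arg_min (\<lambda>a. F (x + a *\<^sub>R d)) (\<lambda>a. a \<ge> 0) a" and x': "x' = x + a *\<^sub>R d"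
    using step unfolding qn_step_def by blast
  \<comment> \<open>The condition \<open>s \<bullet> y \<noteq> 0\<close> in \<open>qn_step\<close>
    excludes a zero step. Hence the step length is positive and the first-order condition of the
    line search applies.\<close>
  have "x' - x \<noteq> 0"
    using step unfolding qn_step_def Let_def by auto
  then have "a \<noteq> 0" "d \<noteq> 0"
    using x' by auto
  then have "a > 0"
    using min unfolding is_arg_min_def by auto
  have "d \<bullet> (B *v d) > 0"
    using step \<open>d \<noteq> 0\<close> unfolding qn_step_def sym_pos_def_def by blast
  then have "grad F x \<bullet> d < 0"
    unfolding d by (simp add: inner_commute)
  moreover have "grad F x' \<bullet> d = 0"
    unfolding x' using smooth_differentiable[OF smooth] min \<open>a > 0\<close>
    by (rule exact_line_search_orthogonal)
  ultimately show thesis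
    using that d \<open>a > 0\<close> x' min by blast
qed

text \<open>This is the induction step for the matrices: the perturbation along the old gradient is
  traded for one along the new gradient. It applies \<open>broyden_plus_outer\<close> with
  \<open>l = - a\<close>, because \<open>B *v (x' - x)\<close> is \<open>a\<close> times
  \<open>B *v d\<close>.\<close>

lemma broyden_of_qn_step_bfgs:
  fixes B :: "real ^ 'n ^ 'n"
  assumes step: "qn_step F bfgs x B x' B'" and smooth: "smooth F" and "c \<ge> 0" and "\<phi> \<ge> 0"
  obtains c' where "c' \<ge> 0"
    and "broyden \<phi> (B + c *\<^sub>R outer (grad F x) (grad F x)) (x' - x) (grad F x' - grad F x)
      = B' + c' *\<^sub>R outer (grad F x') (grad F x')"
proof -
  let ?g = "grad F x"
  obtain d a where d: "B *v d = - ?g" and "a > 0" and x': "x' = x + a *\<^sub>R d"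
    and gd: "?g \<bullet> d < 0" and g'd: "grad F x' \<bullet> d = 0"
    using qn_step_exactE[OF step smooth] by blast
  have s: "x' - x = a *\<^sub>R d"
    by (simp add: x')
  have gs: "?g \<bullet> (x' - x) < 0"
    using gd \<open>a > 0\<close> by (simp add: s mult_pos_neg)
  have B': "B' = bfgs B (x' - x) (grad F x' - ?g)"
    using step by (simp add: qn_step_def Let_def)
  have "broyden \<phi> (B + c *\<^sub>R outer ?g ?g) (x' - x) (grad F x' - ?g)
      = B' + (\<phi> * (- a + c * (?g \<bullet> (x' - x))) / (?g \<bullet> (x' - x))) *\<^sub>R outer (grad F x') (grad F x')"
    unfolding B'
  proof (rule broyden_plus_outer)
    show "transpose B = B"
      using step by (simp add: qn_step_def sym_pos_def_def)
    show "B *v (x' - x) = (- a) *\<^sub>R ?g"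
      by (simp add: s d matrix_vector_mult_scaleR)
    show "grad F x' \<bullet> (x' - x) = 0"
      by (simp add: s g'd)
  qed (use gs \<open>a > 0\<close> \<open>c \<ge> 0\<close> in auto)
  \<comment> \<open>Together with the negative denominator \<open>?g \<bullet> (x' - x)\<close>,
    this makes the new coefficient nonnegative, so positive definiteness persists.\<close>
  moreover have "\<phi> * (- a + c * (?g \<bullet> (x' - x))) \<le> 0"
    using \<open>\<phi> \<ge> 0\<close> \<open>a > 0\<close> \<open>c \<ge> 0\<close> gs
    by (intro mult_nonneg_nonpos) (auto intro: order.trans[OF mult_nonneg_nonpos])
  ultimately show thesis
    using that gs by (meson divide_nonpos_neg)
qed

text \<open>The rank-one term maps \<open>d\<close> to a multiple of \<open>g\<close>, as does
  \<open>B\<close>. The perturbed matrix therefore has the same search direction up to a positive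
  factor.\<close>

lemma direction_plus_outer:
  assumes "B *v d = - g" and "g \<bullet> d < 0" and "c \<ge> 0"
  shows "1 - c * (g \<bullet> d) > 0"
    and "(B + c *\<^sub>R outer g g) *v ((1 / (1 - c * (g \<bullet> d))) *\<^sub>R d) = - g"
proof -
  show pos: "1 - c * (g \<bullet> d) > 0"
    using mult_nonneg_nonpos[of c "g \<bullet> d"] assms(2,3) by simp
  have "(B + c *\<^sub>R outer g g) *v d = (1 - c * (g \<bullet> d)) *\<^sub>R (- g)"
    by (simp add: matrix_vector_mult_add_rdistrib scaleR_matrix_vector_assoc[symmetric]
        outer_mult_vector assms(1) algebra_simps)
  then show "(B + c *\<^sub>R outer g g) *v ((1 / (1 - c * (g \<bullet> d))) *\<^sub>R d) = - g"
    using pos by (simp add: matrix_vector_mult_scaleR)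
qed

text \<open>Existence half of the comparison. The update formula affects only the resulting matrix,
  not the new point, so \<open>U\<close> and \<open>V\<close> may be unrelated.\<close>

lemma qn_step_plus_outer:
  fixes B :: "real ^ 'n ^ 'n" and U :: "real ^ 'n ^ 'n \<Rightarrow> real ^ 'n \<Rightarrow> real ^ 'n \<Rightarrow> real ^ 'n ^ 'n"
  assumes step: "qn_step F V x B x' B'" and smooth: "smooth F" and "c \<ge> 0"
  defines "A \<equiv> B + c *\<^sub>R outer (grad F x) (grad F x)"
  shows "qn_step F U x A x' (U A (x' - x) (grad F x' - grad F x))"
proof -
  let ?g = "grad F x"
  obtain d a where d: "B *v d = - ?g" and "a > 0" and x': "x' = x + a *\<^sub>R d"
    and min: "is_arg_min (\<lambda>a. F (x + a *\<^sub>R d)) (\<lambda>a. a \<ge> 0) a" and gd: "?g \<bullet> d < 0"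
    using qn_step_exactE[OF step smooth] by blast
  define t where "t = 1 - c * (?g \<bullet> d)"
  have t: "t > 0" "A *v ((1 / t) *\<^sub>R d) = - ?g"
    using direction_plus_outer[OF d gd \<open>c \<ge> 0\<close>] by (simp_all add: t_def A_def)
  \<comment> \<open>The direction shrinks by the factor \<open>t\<close> and the step length grows
    by it, so the displacement is unchanged.\<close>
  have "is_arg_min (\<lambda>b. F (x + b *\<^sub>R ((1 / t) *\<^sub>R d))) (\<lambda>b. b \<ge> 0) (a * t)"
    using min t(1) by (subst line_search_scale) simp_all
  moreover have "x' = x + (a * t) *\<^sub>R ((1 / t) *\<^sub>R d)"
    using x' t(1) by simp
  moreover have A: "sym_pos_def A"
    unfolding A_def using step \<open>c \<ge> 0\<close> by (intro sym_pos_def_plus_outer) (simp_all add: qn_step_def)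
  moreover have "(x' - x) \<bullet> (grad F x' - ?g) \<noteq> 0"
    using step by (simp add: qn_step_def Let_def)
  moreover from this have "(x' - x) \<bullet> (A *v (x' - x)) \<noteq> 0"
    using A unfolding sym_pos_def_def by (metis inner_zero_left less_irrefl)
  ultimately show ?thesis
    unfolding qn_step_def Let_def using t(2) by blast
qed

text \<open>Uniqueness half of the comparison: positive definiteness determines the search
  direction, and strong convexity determines the step length along it.\<close>

lemma qn_step_plus_outer_unique:
  fixes B :: "real ^ 'n ^ 'n"
  assumes step: "qn_step F V x B x' B'" and smooth: "smooth F" and "strongly_convex F"
    and "c \<ge> 0" and step': "qn_step F U x (B + c *\<^sub>R outer (grad F x) (grad F x)) z A'"
  shows "z = x'"
proof -
  let ?g = "grad F x" and ?A = "B + c *\<^sub>R outer (grad F x) (grad F x)"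
  obtain d a where d: "B *v d = - ?g" and x': "x' = x + a *\<^sub>R d"
    and min: "is_arg_min (\<lambda>a. F (x + a *\<^sub>R d)) (\<lambda>a. a \<ge> 0) a" and gd: "?g \<bullet> d < 0"
    using qn_step_exactE[OF step smooth] by blast
  define t where "t = 1 - c * (?g \<bullet> d)"
  have t: "t > 0" "?A *v ((1 / t) *\<^sub>R d) = - ?g"
    using direction_plus_outer[OF d gd \<open>c \<ge> 0\<close>] by (simp_all add: t_def)
  obtain e b where e: "?A *v e = - ?g" and z: "z = x + b *\<^sub>R e"
    and min': "is_arg_min (\<lambda>b. F (x + b *\<^sub>R e)) (\<lambda>b. b \<ge> 0) b"
    using step' unfolding qn_step_def by blast
  have e': "e = (1 / t) *\<^sub>R d"
    using step' e t(2) unfolding qn_step_def by (metis sym_pos_def_mult_vector_cancel)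
  have "b * (1 / t) = a"
  proof (rule strongly_convex_line_search_unique[OF assms(3) _ _ min])
    show "d \<noteq> 0"
      using gd by auto
    show "is_arg_min (\<lambda>a. F (x + a *\<^sub>R d)) (\<lambda>a. a \<ge> 0) (b * (1 / t))"
      using min' t(1) unfolding e' by (subst (asm) line_search_scale) simp_all
  qed
  then show ?thesis
    unfolding z e' x' by (metis scaleR_scaleR)
qed

section \<open>Comparison of whole runs\<close>

theorem corollary5p1:
  fixes F :: "real ^ 'n \<Rightarrow> real" and x0 :: "real ^ 'n" and \<epsilon> R :: real
    and x :: "nat \<Rightarrow> real ^ 'n" and B :: "nat \<Rightarrow> real ^ 'n ^ 'n" and \<phi> :: "nat \<Rightarrow> real"
  assumes "CARD('n) \<ge> 2" and "\<epsilon> > 0" and "R > 0"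
    and "smooth F" and "strongly_convex F"
    and "smooth (\<lambda>z. F z - Q z)" and "compact (supp (\<lambda>z. F z - Q z))"
    and "supp (\<lambda>z. F z - Q z) \<union> {x0} \<subseteq> ball 0 R"
    and "bdd_above (range (\<lambda>z. op_norm (hessian F z - mat 1)))"
    and "(SUP z. op_norm (hessian F z - mat 1)) < \<epsilon>"
    and "\<forall>z. is_arg_min F (\<lambda>_. True) z \<longleftrightarrow> z = 0"
    and "hessian F 0 = mat 1"
    and "qn_run F (\<lambda>k. bfgs) x0 (mat 1) x B"
    and "\<forall>k. sym_pos_def (B k)"
    and "nonterminating F x"
    and "x \<longlonglongrightarrow> 0"
    and "(\<lambda>k. norm (x (Suc k)) / norm (x k)) \<longlonglongrightarrow> 0"
    and "has_Q_order x 0 1"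
    and "\<forall>k. \<phi> k \<in> {0..1}"
  shows "(\<exists>x' B'. qn_run F (\<lambda>k. broyden (\<phi> k)) x0 (mat 1) x' B' \<and> nonterminating F x' \<and>
            (\<forall>k. x' k = x k) \<and> Q_superlinear x' 0 \<and> has_Q_order x' 0 1) \<and>
         (\<forall>N x' B'. qn_run_upto F (\<lambda>k. broyden (\<phi> k)) x0 (mat 1) N x' B' \<longrightarrow>
            (\<forall>k\<le>N. x' k = x k))"
proof -
  have step: "qn_step F bfgs (x k) (B k) (x (Suc k)) (B (Suc k))" for k
    using assms(13) unfolding qn_run_def qn_run_upto_def by blast
  have init: "x 0 = x0" "B 0 = mat 1"
    using assms(13) unfolding qn_run_def qn_run_upto_def by blast+
  have \<phi>: "\<phi> k \<ge> 0" for k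
    using assms(19) by auto
  let ?A = "\<lambda>k c. B k + c *\<^sub>R outer (grad F (x k)) (grad F (x k))"
  \<comment> \<open>The Broyden matrices are computed along the given BFGS points. Only afterwards
    is it verified that these points and matrices form a Broyden run.\<close>
  define B' where "B' = rec_nat (mat 1)
    (\<lambda>k A. broyden (\<phi> k) A (x (Suc k) - x k) (grad F (x (Suc k)) - grad F (x k)))"
  have B'_Suc: "B' (Suc k)
      = broyden (\<phi> k) (B' k) (x (Suc k) - x k) (grad F (x (Suc k)) - grad F (x k))" for k
    by (simp add: B'_def)
  have B'_form: "\<exists>c\<ge>0. B' k = ?A k c" for k
  proof (induction k)
    case 0
    show ?case
      by (intro exI[of _ 0]) (simp add: B'_def init)
  next
    case (Suc k)
    then obtain c where "c \<ge> 0" and c: "B' k = ?A k c"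
      by blast
    then show ?case
      unfolding B'_Suc c using broyden_of_qn_step_bfgs[OF step assms(4) _ \<phi>] by metis
  qed
  have "qn_step F (broyden (\<phi> k)) (x k) (B' k) (x (Suc k)) (B' (Suc k))" for k
    using B'_form[of k] qn_step_plus_outer[OF step assms(4)] unfolding B'_Suc by metis
  moreover have "B' 0 = mat 1"
    by (simp add: B'_def)
  ultimately have "qn_run F (\<lambda>k. broyden (\<phi> k)) x0 (mat 1) x B'"
    unfolding qn_run_def qn_run_upto_def using init by blast
  moreover have "Q_superlinear x 0"
    \<comment> \<open>The Q-order hypothesis supplies that the iterates eventually differ from the
      limit, which the ratio limit alone does not give.\<close>
    using assms(17,18) unfolding Q_superlinear_def has_Q_order_def Q_order_at_least_def by auto
  moreover have "\<forall>k\<le>N. z k = x k"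
    if run: "qn_run_upto F (\<lambda>k. broyden (\<phi> k)) x0 (mat 1) N z A" for N z A
  proof -
    \<comment> \<open>The form of the matrix is carried along in the induction, since the points
      alone do not determine the next iteration.\<close>
    have "k \<le> N \<Longrightarrow> z k = x k \<and> (\<exists>c\<ge>0. A k = ?A k c)" for k
    proof (induction k)
      case 0
      then show ?case
        using run init by (auto simp: qn_run_upto_def intro!: exI[of _ 0])
    next
      case (Suc k)
      then obtain c where zk: "z k = x k" and "c \<ge> 0" and c: "A k = ?A k c"
        by auto
      have step': "qn_step F (broyden (\<phi> k)) (x k) (?A k c) (z (Suc k)) (A (Suc k))"
        using run Suc.prems zk c unfolding qn_run_upto_def by (metis Suc_le_lessD)
      have z: "z (Suc k) = x (Suc k)"
        using qn_step_plus_outer_unique[OF step assms(4,5) \<open>c \<ge> 0\<close> step'] .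
      have "A (Suc k)
          = broyden (\<phi> k) (?A k c) (x (Suc k) - x k) (grad F (x (Suc k)) - grad F (x k))"
        using step' unfolding qn_step_def Let_def z by blast
      then show ?case
        using z broyden_of_qn_step_bfgs[OF step assms(4) \<open>c \<ge> 0\<close> \<phi>] by metis
    qed
    then show ?thesis
      by blast
  qed
  ultimately show ?thesis
    using assms(15,18) by blast
qed

end
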